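(* Let $G=(V,E,c)$ be a quasi-bipartite $k$-terminal network, and let $\varepsilon\in(0,\tfrac18)$. Then $G$ admits a flow sparsifier $\widehat G$ of quality $1+\varepsilon$ with $(1/\varepsilon)^{\tilde O(k)}$ vertices.
   Context: A $k$-terminal network $G=(V,E,c)$ is a finite connected undirected graph with nonnegative edge capacities and a set $T\subseteq V$ of $k$ terminals; it is quasi-bipartite if $V\setminus T$ is an independent set. A demand vector $\mathbf d\in\mathbb R_+^{\binom T2}$ can be routed if a multicommodity flow simultaneously sends $d_{st}$ units between each terminal pair with total flow on each edge at most its capacity; for nonzero $\mathbf d$, $\lambda_G(\mathbf d)=\sup\{\lambda\ge0:\lambda\mathbf d\text{ can be routed in }G\}$. A network $G'=(V',E',c')$ with $T\subseteq V'$ is a flow sparsifier of $G$ of quality $q\ge1$ if $\lambda_G(\mathbf d)\le\lambda_{G'}(\mathbf d)\le q\lambda_G(\mathbf d)$ for all nonzero $\mathbf d$. $\tilde O$ hides polylogarithmic factors. *)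

theory Defs
  imports Complex_Main "HOL-Library.Ramsey" "HOL-Library.Landau_Symbols"
begin

text \<open>
  Here \<open>nsets A 2\<close>, written \<open>[A]\<^bsup>2\<^esup>\<close>, is the set of two-element subsets of \<open>A\<close>.
  It serves both for undirected edges and for unordered terminal pairs.
  Only the values of \<open>cap\<close> on \<open>edges\<close> are relevant.
\<close>

record 'a network =
  verts :: "'a set"
  edges :: "'a set set"
  cap :: "'a set \<Rightarrow> real"

definition paths :: "'a network \<Rightarrow> 'a list set" where
  "paths G = {p. p \<noteq> [] \<and> distinct p \<and> set p \<subseteq> verts G
                 \<and> successively (\<lambda>u v. {u, v} \<in> edges G) p}"

definition path_edges :: "'a list \<Rightarrow> 'a set set" where
  "path_edges p = {{p ! i, p ! Suc i} | i. Suc i < length p}"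

definition connected_network :: "'a network \<Rightarrow> bool" where
  "connected_network G \<longleftrightarrow>
     verts G \<noteq> {} \<and> (\<forall>u\<in>verts G. \<forall>v\<in>verts G. \<exists>p\<in>paths G. hd p = u \<and> last p = v)"

definition terminal_network :: "'a network \<Rightarrow> 'a set \<Rightarrow> bool" where
  "terminal_network G T \<longleftrightarrow>
     finite (verts G) \<and> edges G \<subseteq> [verts G]\<^bsup>2\<^esup> \<and> (\<forall>e\<in>edges G. 0 \<le> cap G e)
     \<and> connected_network G \<and> T \<subseteq> verts G"

definition quasi_bipartite :: "'a network \<Rightarrow> 'a set \<Rightarrow> bool" where
  "quasi_bipartite G T \<longleftrightarrow> (\<forall>u\<in>verts G - T. \<forall>v\<in>verts G - T. {u, v} \<notin> edges G)"

text \<open>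
  A demand vector is a function on sets of which only the values on \<open>[T]\<^bsup>2\<^esup>\<close> are relevant.
\<close>

definition nonzero_demand :: "'a set \<Rightarrow> ('a set \<Rightarrow> real) \<Rightarrow> bool" where
  "nonzero_demand T d \<longleftrightarrow> (\<forall>P\<in>[T]\<^bsup>2\<^esup>. 0 \<le> d P) \<and> (\<exists>P\<in>[T]\<^bsup>2\<^esup>. d P \<noteq> 0)"

definition terminal_paths :: "'a network \<Rightarrow> 'a set \<Rightarrow> 'a list set" where
  "terminal_paths G T = {p \<in> paths G. {hd p, last p} \<in> [T]\<^bsup>2\<^esup>}"

text \<open>
  A multicommodity flow assigns an amount \<open>h p\<close> to every simple path \<open>p\<close> joining two distinct
  terminals. A path and its reversal are different lists with the same edges and the same
  unordered pair of endpoints; their contributions add up both in the amount sent and in the load.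
\<close>

definition routable :: "'a network \<Rightarrow> 'a set \<Rightarrow> ('a set \<Rightarrow> real) \<Rightarrow> bool" where
  "routable G T d \<longleftrightarrow> (\<exists>h :: 'a list \<Rightarrow> real.
     (\<forall>p\<in>terminal_paths G T. 0 \<le> h p) \<and>
     (\<forall>P\<in>[T]\<^bsup>2\<^esup>. (\<Sum>p | p \<in> terminal_paths G T \<and> {hd p, last p} = P. h p) = d P) \<and>
     (\<forall>e\<in>edges G. (\<Sum>p | p \<in> terminal_paths G T \<and> e \<in> path_edges p. h p) \<le> cap G e))"

text \<open>
  For a nonzero demand the set below contains \<open>0\<close> and is bounded above (see
  \<open>bdd_above_concurrent_flow\<close>), so the real-valued supremum is the intended one.
\<close>

definition concurrent_flow :: "'a network \<Rightarrow> 'a set \<Rightarrow> ('a set \<Rightarrow> real) \<Rightarrow> real" where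
  "concurrent_flow G T d = Sup {l. 0 \<le> l \<and> routable G T (\<lambda>P. l * d P)}"

definition flow_sparsifier :: "'a network \<Rightarrow> 'a set \<Rightarrow> real \<Rightarrow> 'a network \<Rightarrow> bool" where
  "flow_sparsifier G T q H \<longleftrightarrow>
     1 \<le> q \<and> terminal_network H T \<and>
     (\<forall>d. nonzero_demand T d \<longrightarrow>
        concurrent_flow G T d \<le> concurrent_flow H T d \<and>
        concurrent_flow H T d \<le> q * concurrent_flow G T d)"

text \<open>
  Polylogarithmic factors are powers of the logarithm of the function itself: \<open>f\<close> is soft-O
  of \<open>g\<close> iff \<open>f = O(g (ln g)^a)\<close> at infinity for some \<open>a\<close>.
\<close>

definition soft_bigo :: "(nat \<Rightarrow> real) \<Rightarrow> (nat \<Rightarrow> real) set" where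
  "soft_bigo g = (\<Union>a::nat. O(\<lambda>n. g n * ln (g n) ^ a))"

lemma finite_terminal_paths:
  assumes "finite (verts G)"
  shows "finite (terminal_paths G T)"
proof (rule finite_subset)
  show "terminal_paths G T \<subseteq> {p. set p \<subseteq> verts G \<and> distinct p}"
    by (auto simp: terminal_paths_def paths_def)
  show "finite {p. set p \<subseteq> verts G \<and> distinct p}"
    by (rule finite_subset_distinct[OF assms])
qed

lemma routable_zero:
  assumes "terminal_network G T"
  shows "routable G T (\<lambda>P. 0 * d P)"
  unfolding routable_def
  by (rule exI[of _ "\<lambda>_. 0"]) (use assms in \<open>auto simp: terminal_network_def\<close>)

lemma bdd_above_concurrent_flow:
  assumes G: "terminal_network G T" and d: "nonzero_demand T d"
  shows "bdd_above {l. 0 \<le> l \<and> routable G T (\<lambda>P. l * d P)}"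
proof -
  obtain P where P: "P \<in> [T]\<^bsup>2\<^esup>" and "d P \<noteq> 0" and "0 \<le> d P"
    using d unfolding nonzero_demand_def by blast
  then have pos: "d P > 0" by simp
  have fV: "finite (verts G)" and E: "edges G \<subseteq> [verts G]\<^bsup>2\<^esup>"
    using G by (auto simp: terminal_network_def)
  have fE: "finite (edges G)"
    using E fV by (meson finite_imp_finite_nsets finite_subset)
  define TP where "TP = terminal_paths G T"
  have fTP: "finite TP" unfolding TP_def by (rule finite_terminal_paths[OF fV])
  have hit: "\<exists>e\<in>edges G. e \<in> path_edges p" if p: "p \<in> TP" for p
  proof -
    have p': "p \<noteq> []" "successively (\<lambda>u v. {u, v} \<in> edges G) p" "card {hd p, last p} = 2"
      using p by (auto simp: TP_def terminal_paths_def paths_def nsets_def)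
    obtain x y ys where xy: "p = x # y # ys"
      using p'(1,3) by (cases p; cases "tl p") auto
    have "{x, y} \<in> path_edges p"
      unfolding path_edges_def using xy by force
    then show ?thesis using p'(2) xy by auto
  qed
  show ?thesis
  proof (rule bdd_aboveI)
    fix l assume "l \<in> {l. 0 \<le> l \<and> routable G T (\<lambda>P. l * d P)}"
    then obtain h where h0: "\<And>p. p \<in> TP \<Longrightarrow> 0 \<le> h p"
      and hd: "(\<Sum>p | p \<in> TP \<and> {hd p, last p} = P. h p) = l * d P"
      and hc: "\<And>e. e \<in> edges G \<Longrightarrow> (\<Sum>p | p \<in> TP \<and> e \<in> path_edges p. h p) \<le> cap G e"
      using P unfolding routable_def TP_def by auto
    have "l * d P \<le> (\<Sum>p\<in>TP. h p)"
      unfolding hd[symmetric] by (rule sum_mono2) (use fTP h0 in auto)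
    also have "\<dots> \<le> (\<Sum>p\<in>TP. \<Sum>e\<in>edges G. if e \<in> path_edges p then h p else 0)"
    proof (rule sum_mono)
      fix p assume p: "p \<in> TP"
      from hit[OF p] obtain e where e: "e \<in> edges G" "e \<in> path_edges p" by blast
      show "h p \<le> (\<Sum>e\<in>edges G. if e \<in> path_edges p then h p else 0)"
        using member_le_sum[OF e(1), of "\<lambda>e. if e \<in> path_edges p then h p else 0"] e h0[OF p] fE
        by simp
    qed
    also have "\<dots> = (\<Sum>e\<in>edges G. \<Sum>p\<in>TP. if e \<in> path_edges p then h p else 0)"
      by (rule sum.swap)
    also have "\<dots> = (\<Sum>e\<in>edges G. \<Sum>p | p \<in> TP \<and> e \<in> path_edges p. h p)"
      by (rule sum.cong[OF refl], rule sum.mono_neutral_cong_right) (use fTP in auto)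
    also have "\<dots> \<le> (\<Sum>e\<in>edges G. cap G e)"
      by (rule sum_mono) (rule hc)
    finally show "l \<le> (\<Sum>e\<in>edges G. cap G e) / d P"
      using pos by (simp add: field_simps)
  qed
qed

end

theory Submission
  imports Defs "HOL-Library.FuncSet"
begin

text \<open>
  Nonterminals whose stars have nearly the same shape are contracted to one vertex. Contraction only
  helps routing. For the converse, a hop \<open>s - m - t\<close> through a contracted vertex is distributed over
  the members \<open>v\<close> of its class in proportion to the capacity of \<open>v\<close> at the weaker of \<open>s\<close> and \<open>t\<close>.
  If within the class the ratio of the capacities at \<open>s\<close> and \<open>t\<close> is constant up to a factor \<open>1 + O(\<epsilon>)\<close>,
  both edges at \<open>v\<close> are overloaded by at most that factor; if the weaker capacity is always an
  \<open>O(\<epsilon> / k)\<close> fraction of the stronger one, then all such hops together overload the stronger edge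
  by a factor of at most \<open>1 + O(\<epsilon>)\<close>. So the type of a star only has to record the logarithms of its
  capacities with long gaps shortened, which takes \<open>poly (k / \<epsilon>)\<close> values per terminal.
\<close>

section \<open>Walks\<close>

lemma path_edges_simps [simp]:
  "path_edges [] = {}"
  "path_edges [x] = {}"
  "path_edges (x # y # xs) = insert {x, y} (path_edges (y # xs))"
proof -
  show "path_edges (x # y # xs) = insert {x, y} (path_edges (y # xs))"
  proof (intro equalityI subsetI)
    fix e assume "e \<in> path_edges (x # y # xs)"
    then obtain i where i: "Suc i < length (x # y # xs)"
      "e = {(x # y # xs) ! i, (x # y # xs) ! Suc i}"
      unfolding path_edges_def by blast
    then show "e \<in> insert {x, y} (path_edges (y # xs))"
      by (cases i) (auto simp: path_edges_def)
  next
    fix e assume "e \<in> insert {x, y} (path_edges (y # xs))"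
    then consider "e = {x, y}"
      | i where "Suc i < length (y # xs)" "e = {(y # xs) ! i, (y # xs) ! Suc i}"
      unfolding path_edges_def by blast
    then show "e \<in> path_edges (x # y # xs)"
    proof cases
      case 1
      then show ?thesis unfolding path_edges_def by (auto intro!: exI[of _ 0])
    next
      case 2
      then show ?thesis unfolding path_edges_def by (auto intro!: exI[of _ "Suc i"])
    qed
  qed
qed (auto simp: path_edges_def)

lemma path_edges_append:
  "path_edges (xs @ y # zs) = path_edges (xs @ [y]) \<union> path_edges (y # zs)"
proof (induction xs)
  case (Cons x xs)
  then show ?case by (cases xs) auto
qed simp

lemma path_edges_map: "path_edges (map f p) = (`) f ` path_edges p"
  by (induction p rule: induct_list012) auto

lemma path_edges_subset: "e \<in> path_edges p \<Longrightarrow> e \<subseteq> set p"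
  by (induction p rule: induct_list012) auto

lemma successively_iff_path_edges:
  "successively (\<lambda>u v. {u, v} \<in> E) p \<longleftrightarrow> path_edges p \<subseteq> E"
  by (induction p rule: induct_list012) auto

lemma paths_iff:
  "p \<in> paths G \<longleftrightarrow> p \<noteq> [] \<and> distinct p \<and> set p \<subseteq> verts G \<and> path_edges p \<subseteq> edges G"
  by (simp add: paths_def successively_iff_path_edges)

text \<open>If a vertex repeats, cutting out the closed piece between two of its occurrences gives a
  shorter walk with the same ends and no new edges.\<close>

lemma walk_contains_path:
  assumes "w \<noteq> []"
  shows "\<exists>p. p \<noteq> [] \<and> distinct p \<and> set p \<subseteq> set w \<and> path_edges p \<subseteq> path_edges w
    \<and> hd p = hd w \<and> last p = last w"
  using assms
proof (induction w rule: length_induct)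
  case (1 w)
  show ?case
  proof (cases "distinct w")
    case True
    then show ?thesis using "1.prems" by blast
  next
    case False
    then obtain xs y ys zs where w: "w = xs @ [y] @ ys @ [y] @ zs"
      using not_distinct_decomp by blast
    define v where "v = xs @ y # zs"
    have e: "path_edges v \<subseteq> path_edges w"
      unfolding v_def w path_edges_append[of xs y zs]
      using path_edges_append[of xs y "ys @ [y] @ zs"] path_edges_append[of "y # ys" y zs] by auto
    have h: "hd v = hd w" "last v = last w" "set v \<subseteq> set w" "v \<noteq> []" "length v < length w"
      unfolding v_def w by (auto simp: hd_append)
    then obtain p where "p \<noteq> []" "distinct p" "set p \<subseteq> set v" "path_edges p \<subseteq> path_edges v"
      "hd p = hd v" "last p = last v"
      using 1 by blast
    then show ?thesis using e h by (metis order_trans)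
  qed
qed

text \<open>A simple path visits \<open>m\<close> once, so only the edges to its predecessor and
  successor contain it. These two neighbours are the ends of the hop through \<open>m\<close> that
  is to be lifted.\<close>

lemma interior_vertex_nbrs:
  assumes "distinct p" "m \<in> set p" "hd p \<noteq> m" "last p \<noteq> m"
  shows "\<exists>s t. s \<noteq> t \<and> {x. {x, m} \<in> path_edges p} = {s, t}"
proof -
  obtain as bs where p: "p = as @ m # bs" using assms(2) by (meson split_list)
  have "as \<noteq> []" "bs \<noteq> []" using assms(3,4) p by auto
  then obtain as' s t bs' where ab: "as = as' @ [s]" "bs = t # bs'"
    by (metis list.exhaust rev_exhaust)
  have p': "p = as' @ s # m # t # bs'" by (simp add: p ab)
  have "path_edges p = path_edges (as' @ [s]) \<union> {{s, m}, {m, t}} \<union> path_edges (t # bs')"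
    unfolding p' using path_edges_append[of as' s "m # t # bs'"] by auto
  moreover have "m \<notin> e" if "e \<in> path_edges (as' @ [s]) \<union> path_edges (t # bs')" for e
    using that path_edges_subset[of e "as' @ [s]"] path_edges_subset[of e "t # bs'"] assms(1) p' by auto
  ultimately have "{x. {x, m} \<in> path_edges p} = {s, t}"
    by (auto simp: doubleton_eq_iff)
  moreover have "s \<noteq> t" using assms(1) p' by auto
  ultimately show ?thesis by blast
qed

text \<open>A union bound: points in several of the sets are counted repeatedly on the right,
  harmless for nonnegative summands. It bounds the load of a merged edge by the loads of its
  preimages.\<close>

lemma sum_UN_le:
  fixes f :: "'a \<Rightarrow> real"
  assumes "finite E" and "\<And>e. e \<in> E \<Longrightarrow> finite (A e)"
    and "\<And>e x. e \<in> E \<Longrightarrow> x \<in> A e \<Longrightarrow> 0 \<le> f x"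
  shows "sum f (\<Union>e\<in>E. A e) \<le> (\<Sum>e\<in>E. sum f (A e))"
  using assms
proof (induction E rule: finite_induct)
  case (insert e E)
  have "sum f (A e \<union> (\<Union>e\<in>E. A e)) = sum f (A e) + sum f (\<Union>e\<in>E. A e) - sum f (A e \<inter> (\<Union>e\<in>E. A e))"
    by (rule sum_Un) (use insert in auto)
  moreover have "0 \<le> sum f (A e \<inter> (\<Union>e\<in>E. A e))"
    by (rule sum_nonneg) (use insert.prems in auto)
  moreover have "sum f (\<Union>e\<in>E. A e) \<le> (\<Sum>e\<in>E. sum f (A e))"
    using insert by blast
  ultimately show ?case using insert.hyps by simp
qed simp

text \<open>Shortcutting walks to paths only decreases the load, so a flow may be given by any finite
  weighted family of walks.\<close>

lemma routable_walks:
  assumes fV: "finite (verts G)" and fI: "finite I"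
    and a: "\<And>i. i \<in> I \<Longrightarrow> 0 \<le> a i"
    and walk: "\<And>i. i \<in> I \<Longrightarrow> g i \<noteq> [] \<and> set (g i) \<subseteq> verts G \<and> path_edges (g i) \<subseteq> edges G"
    and ends: "\<And>i. i \<in> I \<Longrightarrow> {hd (g i), last (g i)} \<in> [T]\<^bsup>2\<^esup>"
    and dem: "\<And>P. P \<in> [T]\<^bsup>2\<^esup> \<Longrightarrow> (\<Sum>i | i \<in> I \<and> {hd (g i), last (g i)} = P. a i) = d P"
    and load: "\<And>e. e \<in> edges G \<Longrightarrow> (\<Sum>i | i \<in> I \<and> e \<in> path_edges (g i). a i) \<le> cap G e"
  shows "routable G T d"
proof -
  have "\<exists>p. i \<in> I \<longrightarrow> p \<in> paths G \<and> path_edges p \<subseteq> path_edges (g i)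
    \<and> hd p = hd (g i) \<and> last p = last (g i)" for i
    using walk_contains_path[of "g i"] walk[of i] unfolding paths_iff by (meson order_trans)
  then obtain s where s: "\<And>i. i \<in> I \<Longrightarrow> s i \<in> paths G \<and> path_edges (s i) \<subseteq> path_edges (g i)
    \<and> hd (s i) = hd (g i) \<and> last (s i) = last (g i)"
    by metis
  define TP where "TP = terminal_paths G T"
  have fTP: "finite TP" unfolding TP_def by (rule finite_terminal_paths[OF fV])
  have sTP: "s i \<in> TP" if "i \<in> I" for i
    using s[OF that] ends[OF that] by (simp add: TP_def terminal_paths_def)
  define h where "h p = (\<Sum>i | i \<in> I \<and> s i = p. a i)" for p
  have sum_h: "(\<Sum>p | p \<in> TP \<and> R p. h p) = (\<Sum>i | i \<in> I \<and> R (s i). a i)" for R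
  proof -
    have "(\<Sum>p | p \<in> TP \<and> R p. h p)
        = (\<Sum>p | p \<in> TP \<and> R p. \<Sum>i | i \<in> {i \<in> I. R (s i)} \<and> s i = p. a i)"
      unfolding h_def by (intro sum.cong refl) auto
    also have "\<dots> = (\<Sum>i\<in>{i \<in> I. R (s i)}. a i)"
      by (rule sum.group) (use fTP fI sTP in auto)
    finally show ?thesis by simp
  qed
  show ?thesis unfolding routable_def TP_def[symmetric]
  proof (intro exI[of _ h] conjI ballI)
    show "0 \<le> h p" for p unfolding h_def by (rule sum_nonneg) (use a in auto)
    show "(\<Sum>p | p \<in> TP \<and> {hd p, last p} = P. h p) = d P" if "P \<in> [T]\<^bsup>2\<^esup>" for P
      unfolding sum_h dem[OF that, symmetric] by (rule sum.cong) (use s in auto)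
    show "(\<Sum>p | p \<in> TP \<and> e \<in> path_edges p. h p) \<le> cap G e" if "e \<in> edges G" for e
    proof -
      have "(\<Sum>p | p \<in> TP \<and> e \<in> path_edges p. h p) \<le> (\<Sum>i | i \<in> I \<and> e \<in> path_edges (g i). a i)"
        unfolding sum_h by (rule sum_mono2) (use s a fI in auto)
      with load[OF that] show ?thesis by linarith
    qed
  qed
qed

section \<open>Contractions of quasi-bipartite networks\<close>

text \<open>Edges with the same image merge and their capacities add up. An edge inside a fibre of
  \<open>\<phi>\<close> would become a singleton; under the locale assumptions below this cannot
  occur.\<close>

definition contract :: "('a \<Rightarrow> 'a) \<Rightarrow> 'a network \<Rightarrow> 'a network" where
  "contract \<phi> G = \<lparr>verts = \<phi> ` verts G, edges = (`) \<phi> ` edges G,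
     cap = (\<lambda>e'. \<Sum>e | e \<in> edges G \<and> \<phi> ` e = e'. cap G e)\<rparr>"

lemma contract_simps [simp]:
  "verts (contract \<phi> G) = \<phi> ` verts G"
  "edges (contract \<phi> G) = (`) \<phi> ` edges G"
  "cap (contract \<phi> G) e' = (\<Sum>e | e \<in> edges G \<and> \<phi> ` e = e'. cap G e)"
  by (simp_all add: contract_def)

text \<open>A missing edge counts as one of capacity 0, so every star becomes a total function whose
  support consists of the edges that can carry flow.\<close>

definition star_cap :: "'a network \<Rightarrow> 'a \<Rightarrow> 'a \<Rightarrow> real" where
  "star_cap G v s = (if {v, s} \<in> edges G then cap G {v, s} else 0)"

locale star_contraction =
  fixes G :: "'a network" and T :: "'a set" and \<phi> :: "'a \<Rightarrow> 'a"
  assumes G: "terminal_network G T"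
    and qb: "quasi_bipartite G T"
    and \<phi>_T: "\<And>t. t \<in> T \<Longrightarrow> \<phi> t = t"
    and \<phi>_V: "\<And>v. v \<in> verts G - T \<Longrightarrow> \<phi> v \<in> verts G - T"
begin

abbreviation H :: "'a network" where "H \<equiv> contract \<phi> G"

definition cls :: "'a \<Rightarrow> 'a set" where "cls m = {v \<in> verts G - T. \<phi> v = m}"

lemma finite_verts: "finite (verts G)" and T_verts: "T \<subseteq> verts G"
  and edges_verts: "edges G \<subseteq> [verts G]\<^bsup>2\<^esup>"
  and cap_nonneg: "e \<in> edges G \<Longrightarrow> 0 \<le> cap G e"
  using G by (auto simp: terminal_network_def)

lemma finite_edges: "finite (edges G)"
  using edges_verts finite_verts by (meson finite_imp_finite_nsets finite_subset)

lemma finite_T: "finite T"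
  using T_verts finite_verts finite_subset by blast

lemma finite_cls: "finite (cls m)"
  unfolding cls_def using finite_verts by simp

lemma star_cap_nonneg: "0 \<le> star_cap G v s"
  by (simp add: star_cap_def cap_nonneg)

lemma \<phi>_in_T_iff: "v \<in> verts G \<Longrightarrow> \<phi> v \<in> T \<longleftrightarrow> v \<in> T"
  using \<phi>_T \<phi>_V by (metis Diff_iff)

lemma edgeE:
  assumes "e \<in> edges G"
  obtains u v where "e = {u, v}" "u \<noteq> v" "u \<in> verts G" "v \<in> verts G" "u \<in> T"
proof -
  obtain u v where uv: "e = {u, v}" "u \<noteq> v" "u \<in> verts G" "v \<in> verts G"
    using edges_verts assms by (auto simp: nsets_def card_2_iff)
  then have "u \<in> T \<or> v \<in> T"
    using qb assms by (auto simp: quasi_bipartite_def)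
  then show thesis using uv that[of u v] that[of v u] by (metis insert_commute)
qed

text \<open>Since \<open>\<phi>\<close> fixes terminals and keeps nonterminals outside
  \<open>T\<close>, the images of the two ends stay different and the terminal end survives: there
  are no loops, and the contraction is again quasi-bipartite.\<close>

lemma edge_H_E:
  assumes "e \<in> edges H"
  obtains u v where "e = {u, v}" "u \<noteq> v" "u \<in> verts H" "v \<in> verts H" "u \<in> T"
proof -
  obtain e0 where e0: "e0 \<in> edges G" "e = \<phi> ` e0" using assms by auto
  from e0(1) obtain u v where uv: "e0 = {u, v}" "u \<noteq> v" "u \<in> verts G" "v \<in> verts G" "u \<in> T"
    by (rule edgeE)
  show thesis
  proof (rule that[of u "\<phi> v"])
    show "u \<noteq> \<phi> v" using uv \<phi>_T \<phi>_in_T_iff by metis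
    show "u \<in> verts H" using uv \<phi>_T by force
  qed (use uv e0 \<phi>_T in auto)
qed

section \<open>Passing flows from a network to its contraction\<close>

lemma walk_H:
  assumes "p \<in> paths G"
  shows "map \<phi> p \<noteq> []" "set (map \<phi> p) \<subseteq> verts H" "path_edges (map \<phi> p) \<subseteq> edges H"
  using assms by (auto simp: paths_iff path_edges_map)

lemma terminal_network_H: "terminal_network H T"
proof -
  have "edges H \<subseteq> [verts H]\<^bsup>2\<^esup>"
  proof
    fix e assume "e \<in> edges H"
    then obtain u v where "e = {u, v}" "u \<noteq> v" "u \<in> verts H" "v \<in> verts H"
      by (rule edge_H_E)
    then show "e \<in> [verts H]\<^bsup>2\<^esup>" by (auto simp: nsets_def)
  qed
  moreover have "connected_network H"
    unfolding connected_network_def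
  proof (intro conjI ballI)
    show "verts H \<noteq> {}" using G by (auto simp: terminal_network_def connected_network_def)
    fix u v assume "u \<in> verts H" "v \<in> verts H"
    then obtain u' v' where uv: "u = \<phi> u'" "v = \<phi> v'" "u' \<in> verts G" "v' \<in> verts G" by auto
    then obtain p where p: "p \<in> paths G" "hd p = u'" "last p = v'"
      using G unfolding terminal_network_def connected_network_def by blast
    then have ne: "p \<noteq> []" by (simp add: paths_iff)
    from walk_contains_path[OF walk_H(1)[OF p(1)]] obtain q where
      q: "q \<noteq> []" "distinct q" "set q \<subseteq> set (map \<phi> p)"
        "path_edges q \<subseteq> path_edges (map \<phi> p)"
      and "hd q = hd (map \<phi> p)" "last q = last (map \<phi> p)"
      by blast
    then have "hd q = u \<and> last q = v"
      using uv p ne by (simp add: hd_map last_map)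
    moreover have "q \<in> paths H"
      unfolding paths_iff using q walk_H(2,3)[OF p(1)] by blast
    ultimately show "\<exists>p\<in>paths H. hd p = u \<and> last p = v" by blast
  qed
  moreover have "T \<subseteq> verts H" using T_verts \<phi>_T by force
  ultimately show ?thesis
    using finite_verts by (auto simp: terminal_network_def intro!: sum_nonneg cap_nonneg)
qed

text \<open>Every flow path is replaced by its image walk, with the same weight and, as terminals
  are fixed, the same endpoints.\<close>

lemma routable_H:
  assumes "routable G T d"
  shows "routable H T d"
proof -
  define TP where "TP = terminal_paths G T"
  have fTP: "finite TP" unfolding TP_def by (rule finite_terminal_paths[OF finite_verts])
  obtain h where h0: "\<And>p. p \<in> TP \<Longrightarrow> 0 \<le> h p"
    and hd: "\<And>P. P \<in> [T]\<^bsup>2\<^esup> \<Longrightarrow> (\<Sum>p | p \<in> TP \<and> {hd p, last p} = P. h p) = d P"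
    and hc: "\<And>e. e \<in> edges G \<Longrightarrow> (\<Sum>p | p \<in> TP \<and> e \<in> path_edges p. h p) \<le> cap G e"
    using assms unfolding routable_def TP_def by auto
  have ends: "{hd (map \<phi> p), last (map \<phi> p)} = {hd p, last p}" "{hd p, last p} \<in> [T]\<^bsup>2\<^esup>"
    if "p \<in> TP" for p
  proof -
    have *: "p \<noteq> []" "{hd p, last p} \<in> [T]\<^bsup>2\<^esup>"
      using that by (auto simp: TP_def terminal_paths_def paths_iff)
    then have "hd p \<in> T" "last p \<in> T" by (auto simp: nsets_def)
    then show "{hd (map \<phi> p), last (map \<phi> p)} = {hd p, last p}" "{hd p, last p} \<in> [T]\<^bsup>2\<^esup>"
      using * \<phi>_T by (auto simp: hd_map last_map)
  qed
  show ?thesis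
  proof (rule routable_walks[where I = TP and a = h and g = "map \<phi>"])
    show "finite (verts H)" using finite_verts by simp
    show "map \<phi> p \<noteq> [] \<and> set (map \<phi> p) \<subseteq> verts H \<and> path_edges (map \<phi> p) \<subseteq> edges H"
      if "p \<in> TP" for p
      using walk_H that by (simp add: TP_def terminal_paths_def)
    show "{hd (map \<phi> p), last (map \<phi> p)} \<in> [T]\<^bsup>2\<^esup>" if "p \<in> TP" for p
      using ends[OF that] by simp
    show "(\<Sum>p | p \<in> TP \<and> {hd (map \<phi> p), last (map \<phi> p)} = P. h p) = d P"
      if "P \<in> [T]\<^bsup>2\<^esup>" for P
      unfolding hd[OF that, symmetric] by (rule sum.cong) (use ends in auto)
    fix e' assume "e' \<in> edges H"
    define E where "E = {e \<in> edges G. \<phi> ` e = e'}"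
    have fE: "finite E" unfolding E_def using finite_edges by simp
    \<comment> \<open>An image walk uses \<open>e'\<close> only if the path uses some edge over
      \<open>e'\<close>, and the capacities of those edges add up to that of
      \<open>e'\<close>.\<close>
    have "(\<Sum>p | p \<in> TP \<and> e' \<in> path_edges (map \<phi> p). h p)
        \<le> (\<Sum>p\<in>(\<Union>e\<in>E. {p \<in> TP. e \<in> path_edges p}). h p)"
    proof (rule sum_mono2)
      show "{p \<in> TP. e' \<in> path_edges (map \<phi> p)} \<subseteq> (\<Union>e\<in>E. {p \<in> TP. e \<in> path_edges p})"
        by (auto simp: E_def path_edges_map TP_def terminal_paths_def paths_iff)
    qed (use h0 fTP fE in auto)
    also have "\<dots> \<le> (\<Sum>e\<in>E. \<Sum>p\<in>{p \<in> TP. e \<in> path_edges p}. h p)"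
      by (rule sum_UN_le) (use h0 fTP fE in auto)
    also have "\<dots> \<le> (\<Sum>e\<in>E. cap G e)"
      by (rule sum_mono) (use hc in \<open>auto simp: E_def\<close>)
    finally show "(\<Sum>p | p \<in> TP \<and> e' \<in> path_edges (map \<phi> p). h p) \<le> cap H e'"
      by (simp add: E_def)
  qed (use fTP h0 in auto)
qed

section \<open>Capacities of the contraction and lifting of flows\<close>

definition class_cap :: "'a \<Rightarrow> 'a \<Rightarrow> real" where
  "class_cap m s = (\<Sum>v\<in>cls m. star_cap G v s)"

lemma class_cap_nonneg: "0 \<le> class_cap m s"
  unfolding class_cap_def by (rule sum_nonneg) (rule star_cap_nonneg)

text \<open>A nonterminal is never sent into \<open>T\<close>, so the only edge over
  \<open>e\<close> is \<open>e\<close> itself.\<close>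

lemma cap_H_terminal_edge:
  assumes e: "e \<in> edges H" and eT: "e \<subseteq> T"
  shows "e \<in> edges G" "cap H e = cap G e"
proof -
  have id: "e' = e" if "e' \<in> edges G" "\<phi> ` e' = e" for e'
  proof -
    have "\<phi> u = u" if "u \<in> e'" for u
    proof -
      have "u \<in> verts G" using \<open>e' \<in> edges G\<close> \<open>u \<in> e'\<close> edges_verts by (auto simp: nsets_def)
      moreover have "\<phi> u \<in> T" using \<open>\<phi> ` e' = e\<close> \<open>u \<in> e'\<close> eT by blast
      ultimately show ?thesis using \<phi>_in_T_iff \<phi>_T by blast
    qed
    then show ?thesis using \<open>\<phi> ` e' = e\<close> by auto
  qed
  obtain e' where "e' \<in> edges G" "\<phi> ` e' = e" using e by auto
  with id show "e \<in> edges G" by metis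
  have "{e' \<in> edges G. \<phi> ` e' = e} = {e}"
  proof -
    have "e' = e" by (rule id) fact+
    then have "e \<in> edges G" "\<phi> ` e = e"
      using \<open>e' \<in> edges G\<close> \<open>\<phi> ` e' = e\<close> by simp_all
    then show ?thesis using id by blast
  qed
  then show "cap H e = cap G e" by simp
qed

text \<open>The edges over \<open>{s, m}\<close> join \<open>s\<close> to members of the class of
  \<open>m\<close>; distinct members give distinct edges, and members not adjacent to
  \<open>s\<close> contribute 0.\<close>

lemma cap_H_star_edge:
  assumes m: "m \<notin> T" and s: "s \<in> T"
  shows "cap H {s, m} = class_cap m s"
proof -
  have "{e \<in> edges G. \<phi> ` e = {s, m}} = (\<lambda>v. {v, s}) ` {v \<in> cls m. {v, s} \<in> edges G}"
    (is "?L = ?R")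
  proof (intro equalityI subsetI)
    fix e assume e: "e \<in> ?L"
    then obtain u v where uv: "e = {u, v}" "u \<in> verts G" "v \<in> verts G" "u \<in> T"
      using edgeE by (metis (mono_tags, lifting) mem_Collect_eq)
    have "{u, \<phi> v} = {s, m}" using e uv \<phi>_T by auto
    then have us: "u = s" "\<phi> v = m" using uv m by (auto simp: doubleton_eq_iff)
    then have "v \<in> cls m" using uv m \<phi>_T by (auto simp: cls_def)
    then show "e \<in> ?R" using e uv us by (auto simp: insert_commute)
  next
    fix e assume "e \<in> ?R"
    then show "e \<in> ?L" using s \<phi>_T by (auto simp: cls_def)
  qed
  moreover have "inj_on (\<lambda>v. {v, s}) {v \<in> cls m. {v, s} \<in> edges G}"
    by (auto simp: inj_on_def doubleton_eq_iff)
  ultimately have "cap H {s, m} = (\<Sum>v\<in>{v \<in> cls m. {v, s} \<in> edges G}. cap G {v, s})"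
    by (simp add: sum.reindex)
  also have "\<dots> = class_cap m s"
    unfolding class_cap_def
    by (rule sum.mono_neutral_cong_left) (use finite_cls in \<open>auto simp: star_cap_def\<close>)
  finally show ?thesis .
qed

text \<open>In the proof the hops of a path are lifted independently, so the weight of a lifted path is a
  product. The relation \<open>far m s t\<close> means that \<open>t\<close> is much weaker than \<open>s\<close> in the class of \<open>m\<close>.\<close>

lemma routable_G:
  fixes \<delta> \<rho> q :: real
  assumes asym: "\<And>m s t. far m s t \<Longrightarrow> \<not> far m t s"
    and supp: "\<And>m u v s. \<lbrakk>u \<in> cls m; v \<in> cls m; s \<in> T; 0 < star_cap G u s\<rbrakk> \<Longrightarrow> 0 < star_cap G v s"
    and small: "\<And>m v s t. \<lbrakk>v \<in> cls m; s \<in> T; t \<in> T; 0 < star_cap G v s; 0 < star_cap G v t; far m s t\<rbrakk>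
      \<Longrightarrow> star_cap G v t \<le> \<delta> * star_cap G v s"
    and near: "\<And>m u v s t. \<lbrakk>u \<in> cls m; v \<in> cls m; s \<in> T; t \<in> T; 0 < star_cap G v s; 0 < star_cap G v t;
      \<not> far m s t; \<not> far m t s\<rbrakk>
      \<Longrightarrow> star_cap G v t * star_cap G u s \<le> \<rho> * star_cap G u t * star_cap G v s"
    and \<rho>: "1 \<le> \<rho>" and \<delta>: "0 \<le> \<delta>" and q: "\<rho> + card T * \<delta> \<le> q"
    and rt: "routable H T d"
  shows "routable G T (\<lambda>P. d P / q)"
proof -
  let ?c = "star_cap G" and ?C = class_cap
  define TP where "TP = terminal_paths H T"
  have "0 \<le> real (card T) * \<delta>" using \<delta> by simp
  then have q1: "1 \<le> q" using \<rho> q by linarith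
  have fTP: "finite TP" unfolding TP_def
    by (rule finite_terminal_paths) (use finite_verts in simp)
  obtain h where h0: "\<And>p. p \<in> TP \<Longrightarrow> 0 \<le> h p"
    and dem: "\<And>P. P \<in> [T]\<^bsup>2\<^esup> \<Longrightarrow> (\<Sum>p | p \<in> TP \<and> {hd p, last p} = P. h p) = d P"
    and load: "\<And>e. e \<in> edges H \<Longrightarrow> (\<Sum>p | p \<in> TP \<and> e \<in> path_edges p. h p) \<le> cap H e"
    using rt unfolding routable_def TP_def by auto
  \<comment> \<open>Only paths carrying positive flow are lifted: every edge they use has positive
    capacity, so the class capacities divided by below are nonzero.\<close>
  define PP where "PP = {p \<in> TP. 0 < h p}"
  have fPP: "finite PP" using fTP by (simp add: PP_def)
  have PP_D: "p \<noteq> []" "distinct p" "set p \<subseteq> verts H" "path_edges p \<subseteq> edges H"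
    "{hd p, last p} \<in> [T]\<^bsup>2\<^esup>" "hd p \<in> T" "last p \<in> T" "0 < h p" "p \<in> TP" if "p \<in> PP" for p
  proof -
    have *: "{hd p, last p} \<in> [T]\<^bsup>2\<^esup>"
      using that by (auto simp: PP_def TP_def terminal_paths_def)
    then show "hd p \<in> T" "last p \<in> T" by auto
    show "{hd p, last p} \<in> [T]\<^bsup>2\<^esup>" by (rule *)
  qed (use that in \<open>auto simp: PP_def TP_def terminal_paths_def paths_iff\<close>)
  have flow_le: "(\<Sum>p | p \<in> PP \<and> e \<in> path_edges p. h p) \<le> cap H e" if "e \<in> edges H" for e
  proof -
    have "(\<Sum>p | p \<in> PP \<and> e \<in> path_edges p. h p) \<le> (\<Sum>p | p \<in> TP \<and> e \<in> path_edges p. h p)"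
      by (rule sum_mono2) (use fTP h0 in \<open>auto simp: PP_def\<close>)
    then show ?thesis using load[OF that] by linarith
  qed
  have flow_le_C: "(\<Sum>p | p \<in> PP \<and> {t, m} \<in> path_edges p. h p) \<le> ?C m t"
    if "m \<notin> T" "t \<in> T" for m t
  proof (cases "{t, m} \<in> edges H")
    case True
    show ?thesis using flow_le[OF True] cap_H_star_edge[OF that] by simp
  next
    case False
    then have *: "{p. p \<in> PP \<and> {t, m} \<in> path_edges p} = {}" using PP_D(4) by blast
    show ?thesis unfolding * using class_cap_nonneg by simp
  qed
  define nbr where "nbr p m = {x. {x, m} \<in> path_edges p}" for p and m :: 'a
  have nbr: "\<exists>s t. s \<noteq> t \<and> nbr p m = {s, t}" if "p \<in> PP" "m \<in> set p - T" for p m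
    unfolding nbr_def by (rule interior_vertex_nbrs) (use PP_D[OF that(1)] that(2) in auto)
  have nbr_T: "x \<in> T" and nbr_C: "0 < ?C m x" and nbr_c: "\<And>v. v \<in> cls m \<Longrightarrow> 0 < ?c v x"
    if p: "p \<in> PP" and m: "m \<in> set p - T" and x: "x \<in> nbr p m" for p m x
  proof -
    have e: "{x, m} \<in> path_edges p" using x by (simp add: nbr_def)
    with PP_D(4)[OF p] have eH: "{x, m} \<in> edges H" by blast
    from edge_H_E[OF this] m show xT: "x \<in> T" by (metis Diff_iff doubleton_eq_iff)
    have "h p \<le> (\<Sum>p | p \<in> PP \<and> {x, m} \<in> path_edges p. h p)"
      by (rule member_le_sum) (use p e fPP PP_D(8) in \<open>auto intro: less_imp_le\<close>)
    also have "\<dots> \<le> ?C m x" using flow_le_C xT m by blast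
    finally show C: "0 < ?C m x" using PP_D(8)[OF p] by linarith
    then obtain u where "u \<in> cls m" "0 < ?c u x"
      unfolding class_cap_def by (metis linorder_not_less sum_nonpos)
    then show "\<And>v. v \<in> cls m \<Longrightarrow> 0 < ?c v x" using supp xT by blast
  qed
  \<comment> \<open>The weaker side of the hop: a neighbour of \<open>m\<close> on \<open>p\<close>
    that is not far above the other one. If neither is far above the other, either choice
    works.\<close>
  define r where "r p m = (SOME x. x \<in> nbr p m \<and> (\<forall>y\<in>nbr p m. \<not> far m x y))" for p m
  have r: "r p m \<in> nbr p m" "\<And>y. y \<in> nbr p m \<Longrightarrow> \<not> far m (r p m) y"
    if pm: "p \<in> PP" "m \<in> set p - T" for p m
  proof -
    obtain s t where st: "nbr p m = {s, t}" using nbr[OF pm] by blast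
    have "\<exists>x. x \<in> nbr p m \<and> (\<forall>y\<in>nbr p m. \<not> far m x y)"
      unfolding st
    proof (cases "far m s t")
      case True
      then show "\<exists>x. x \<in> {s, t} \<and> (\<forall>y\<in>{s, t}. \<not> far m x y)"
        using asym by (intro exI[of _ t]) auto
    next
      case False
      then show "\<exists>x. x \<in> {s, t} \<and> (\<forall>y\<in>{s, t}. \<not> far m x y)"
        using asym by (intro exI[of _ s]) auto
    qed
    from someI_ex[OF this]
    show "r p m \<in> nbr p m" "\<And>y. y \<in> nbr p m \<Longrightarrow> \<not> far m (r p m) y"
      unfolding r_def by blast+
  qed
  define wt where "wt p m v = ?c v (r p m) / ?C m (r p m)" for p m v
  have wt0: "0 \<le> wt p m v" for p m v
    unfolding wt_def by (intro divide_nonneg_nonneg star_cap_nonneg class_cap_nonneg)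
  have wt1: "(\<Sum>v\<in>cls m. wt p m v) = 1" if "p \<in> PP" "m \<in> set p - T" for p m
  proof -
    have "0 < ?C m (r p m)" using nbr_C[OF that r(1)[OF that]] .
    then show ?thesis
      unfolding wt_def sum_divide_distrib[symmetric] class_cap_def by simp
  qed
  \<comment> \<open>If \<open>r p m\<close> is not much weaker than \<open>x\<close>, then
    \<open>near\<close> bounds the weight by \<open>\<rho>\<close> times the share of
    \<open>v\<close> at \<open>x\<close>. Otherwise the weight is the share of \<open>v\<close> at
    \<open>r p m\<close>, one term of the sum over the far terminals that \<open>p\<close> joins to
    \<open>m\<close>.\<close>
  have wt_le: "wt p m v \<le> \<rho> * ?c v x / ?C m x
      + (\<Sum>t\<in>T. if far m x t \<and> {t, m} \<in> path_edges p then ?c v t / ?C m t else 0)"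
    (is "_ \<le> ?A + ?S")
    if p: "p \<in> PP" and m: "m \<in> set p - T" and x: "x \<in> nbr p m" and v: "v \<in> cls m" for p m x v
  proof -
    let ?t = "r p m"
    have t: "?t \<in> nbr p m" "\<not> far m ?t x" using r[OF p m] x by auto
    have S0: "0 \<le> ?S" by (rule sum_nonneg) (auto intro: divide_nonneg_nonneg star_cap_nonneg class_cap_nonneg)
    have A0: "0 \<le> ?A" using \<rho> by (auto intro!: divide_nonneg_nonneg mult_nonneg_nonneg star_cap_nonneg class_cap_nonneg)
    show ?thesis
    proof (cases "far m x ?t")
      case True
      have "wt p m v = (if far m x ?t \<and> {?t, m} \<in> path_edges p then ?c v ?t / ?C m ?t else 0)"
        using True t by (simp add: wt_def nbr_def)
      also have "\<dots> \<le> ?S"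
        by (rule member_le_sum[where f = "\<lambda>t. if far m x t \<and> {t, m} \<in> path_edges p then ?c v t / ?C m t else 0"])
          (use nbr_T[OF p m t(1)] finite_T in
            \<open>auto intro: divide_nonneg_nonneg star_cap_nonneg class_cap_nonneg\<close>)
      finally show ?thesis using A0 by linarith
    next
      case False
      \<comment> \<open>Summing \<open>near\<close> over all members \<open>u\<close> turns the
        pointwise ratio bound into one for class capacities.\<close>
      have "?c v ?t * ?C m x = (\<Sum>u\<in>cls m. ?c v ?t * ?c u x)"
        by (simp add: class_cap_def sum_distrib_left)
      also have "\<dots> \<le> (\<Sum>u\<in>cls m. \<rho> * ?c u ?t * ?c v x)"
        by (rule sum_mono, rule near)
          (use False t v nbr_T[OF p m] nbr_c[OF p m _ v] x in auto)
      also have "\<dots> = \<rho> * ?c v x * ?C m ?t"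
        by (simp add: class_cap_def sum_distrib_left mult_ac)
      finally have "wt p m v \<le> ?A"
        unfolding wt_def using nbr_C[OF p m x] nbr_C[OF p m t(1)] by (simp add: field_simps)
      then show ?thesis using S0 by linarith
    qed
  qed
  \<comment> \<open>A lift chooses a member of the class at each nonterminal of \<open>p\<close>
    independently; \<open>W\<close> is the resulting product distribution.\<close>
  define lifts where "lifts p = PiE (set p - T) cls" for p
  define lift where "lift \<chi> x = (if x \<in> T then x else \<chi> x)" for \<chi> :: "'a \<Rightarrow> 'a" and x
  define W where "W p \<chi> = (\<Prod>m\<in>set p - T. wt p m (\<chi> m))" for p \<chi>
  have W0: "0 \<le> W p \<chi>" for p \<chi> unfolding W_def by (rule prod_nonneg) (use wt0 in auto)
  have f_lifts: "finite (lifts p)" for p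
    unfolding lifts_def by (rule finite_PiE) (use finite_cls in auto)
  have sumW: "(\<Sum>\<chi>\<in>lifts p. W p \<chi>) = 1" if "p \<in> PP" for p
    unfolding lifts_def W_def
    by (subst prod_sum_PiE[symmetric]) (use finite_cls wt1[OF that] in auto)
  \<comment> \<open>The marginal at \<open>m\<close>: once this coordinate is fixed, the factors at
    all other nonterminals sum to 1.\<close>
  have sumW_at: "(\<Sum>\<chi>\<in>{\<chi> \<in> lifts p. \<chi> m = v}. W p \<chi>) = wt p m v"
    if p: "p \<in> PP" and m: "m \<in> set p - T" and v: "v \<in> cls m" for p m v
  proof -
    have "{\<chi> \<in> lifts p. \<chi> m = v} = PiE (set p - T) (cls(m := {v}))"
      unfolding lifts_def set_eq_iff using m v by (auto simp: PiE_iff)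
    then have "(\<Sum>\<chi>\<in>{\<chi> \<in> lifts p. \<chi> m = v}. W p \<chi>)
        = (\<Sum>\<chi>\<in>PiE (set p - T) (cls(m := {v})). \<Prod>m'\<in>set p - T. wt p m' (\<chi> m'))"
      by (simp add: W_def)
    also have "\<dots> = (\<Prod>m'\<in>set p - T. \<Sum>v'\<in>(cls(m := {v})) m'. wt p m' v')"
      by (rule prod_sum_PiE[symmetric]) (use finite_cls in auto)
    also have "\<dots> = (\<Prod>m'\<in>set p - T. if m' = m then wt p m v else 1)"
      by (rule prod.cong) (use wt1[OF p] in auto)
    also have "\<dots> = wt p m v" using m by simp
    finally show ?thesis .
  qed
  define I where "I = Sigma PP lifts"
  \<comment> \<open>Dividing by \<open>q\<close> in advance compensates for the overload of the
    lifted flow.\<close>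
  define a where "a = (\<lambda>(p, \<chi>). h p * W p \<chi> / q)"
  define g where "g = (\<lambda>(p, \<chi>). map (lift \<chi>) p)"
  have fI: "finite I" unfolding I_def using fPP f_lifts by auto
  have a0: "0 \<le> a i" if "i \<in> I" for i
    using that W0 q1 by (auto simp: a_def I_def PP_def)
  have sum_all: "(\<Sum>i\<in>Sigma {p \<in> PP. R p} lifts. a i) = (\<Sum>p | p \<in> PP \<and> R p. h p) / q" for R
  proof -
    have "(\<Sum>i\<in>Sigma {p \<in> PP. R p} lifts. a i)
        = (\<Sum>p | p \<in> PP \<and> R p. \<Sum>\<chi>\<in>lifts p. h p * W p \<chi> / q)"
      unfolding a_def by (rule sum.Sigma[symmetric]) (use fPP f_lifts in auto)
    also have "\<dots> = (\<Sum>p | p \<in> PP \<and> R p. h p / q)"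
      by (rule sum.cong) (auto simp: sum_divide_distrib[symmetric] sum_distrib_left[symmetric] sumW)
    finally show ?thesis by (simp add: sum_divide_distrib)
  qed
  have lift_edge: "\<exists>s b. e0 = {s, b} \<and> s \<in> T \<and> lift \<chi> ` e0 = {s, lift \<chi> b}
      \<and> (b \<notin> T \<longrightarrow> b \<in> set p - T \<and> \<chi> b \<in> cls b)"
    if "p \<in> PP" "\<chi> \<in> lifts p" "e0 \<in> path_edges p" for p \<chi> e0
  proof -
    have "e0 \<in> edges H" using PP_D(4) that by blast
    then obtain s b where sb: "e0 = {s, b}" "s \<in> T" by (rule edge_H_E)
    have "b \<in> set p" using path_edges_subset[OF that(3)] sb by auto
    then have "b \<notin> T \<longrightarrow> b \<in> set p - T \<and> \<chi> b \<in> cls b"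
      using that(2) unfolding lifts_def by (blast dest: PiE_mem)
    moreover have "lift \<chi> ` e0 = {s, lift \<chi> b}" using sb by (simp add: lift_def)
    ultimately show ?thesis using sb by blast
  qed
  \<comment> \<open>A star edge on \<open>p\<close> has positive class capacity, hence positive
    capacity at some member and, by \<open>supp\<close>, at every member; so the lifted edge
    exists.\<close>
  have lift_edge_G: "lift \<chi> ` e0 \<in> edges G"
    if i: "p \<in> PP" "\<chi> \<in> lifts p" "e0 \<in> path_edges p" for p \<chi> e0
  proof -
    obtain s b where sb: "e0 = {s, b}" "s \<in> T" "lift \<chi> ` e0 = {s, lift \<chi> b}"
      "b \<notin> T \<Longrightarrow> b \<in> set p - T \<and> \<chi> b \<in> cls b"
      using lift_edge[OF i] by blast
    show ?thesis
    proof (cases "b \<in> T")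
      case True
      have "e0 \<in> edges H" using PP_D(4) i by blast
      then have "e0 \<in> edges G" using cap_H_terminal_edge(1) sb True by auto
      then show ?thesis using sb True by (simp add: lift_def)
    next
      case False
      have "s \<in> nbr p b" using i(3) sb(1) by (simp add: nbr_def)
      then have "0 < ?c (\<chi> b) s" using nbr_c[OF i(1)] sb(4)[OF False] by blast
      then show ?thesis using sb(3) False
        by (auto simp: lift_def star_cap_def insert_commute split: if_splits)
    qed
  qed
  have ends: "{hd (g (p, \<chi>)), last (g (p, \<chi>))} = {hd p, last p}" if "p \<in> PP" for p \<chi>
    using PP_D[OF that] by (simp add: g_def hd_map last_map lift_def)
  show ?thesis
  proof (rule routable_walks[OF finite_verts fI a0, where g = g])
    fix i assume "i \<in> I"
    then obtain p \<chi> where i: "i = (p, \<chi>)" "p \<in> PP" "\<chi> \<in> lifts p" by (auto simp: I_def)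
    have "lift \<chi> x \<in> verts G" if "x \<in> set p" for x
      using i(3) that T_verts by (auto simp: lift_def lifts_def cls_def PiE_iff)
    then show "g i \<noteq> [] \<and> set (g i) \<subseteq> verts G \<and> path_edges (g i) \<subseteq> edges G"
      using PP_D(1)[OF i(2)] lift_edge_G[OF i(2,3)] by (auto simp: g_def i(1) path_edges_map)
    show "{hd (g i), last (g i)} \<in> [T]\<^bsup>2\<^esup>"
      unfolding i(1) ends[OF i(2)] by (rule PP_D(5)[OF i(2)])
  next
    fix P assume P: "P \<in> [T]\<^bsup>2\<^esup>"
    have "{i \<in> I. {hd (g i), last (g i)} = P} = Sigma {p \<in> PP. {hd p, last p} = P} lifts"
      using ends by (auto simp: I_def)
    then have "(\<Sum>i | i \<in> I \<and> {hd (g i), last (g i)} = P. a i)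
        = (\<Sum>p | p \<in> PP \<and> {hd p, last p} = P. h p) / q"
      by (simp add: sum_all)
    also have "(\<Sum>p | p \<in> PP \<and> {hd p, last p} = P. h p) = (\<Sum>p | p \<in> TP \<and> {hd p, last p} = P. h p)"
      by (rule sum.mono_neutral_left) (use fTP h0 in \<open>force simp: PP_def\<close>)+
    finally show "(\<Sum>i | i \<in> I \<and> {hd (g i), last (g i)} = P. a i) = d P / q"
      using dem[OF P] by simp
  next
    fix e assume e: "e \<in> edges G"
    then obtain x v where xv: "e = {x, v}" "x \<in> T" "v \<in> verts G" by (rule edgeE)
    show "(\<Sum>i | i \<in> I \<and> e \<in> path_edges (g i). a i) \<le> cap G e"
    proof (cases "v \<in> T")
      case True
      \<comment> \<open>A lift uses an edge between terminals only if the original path does, since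
        lifted nonterminals lie outside \<open>T\<close>.\<close>
      have "{i \<in> I. e \<in> path_edges (g i)} \<subseteq> Sigma {p \<in> PP. e \<in> path_edges p} lifts"
      proof
        fix i assume "i \<in> {i \<in> I. e \<in> path_edges (g i)}"
        then obtain p \<chi> e0 where i: "i = (p, \<chi>)" "p \<in> PP" "\<chi> \<in> lifts p" "e0 \<in> path_edges p" "e = lift \<chi> ` e0"
          by (auto simp: I_def g_def path_edges_map)
        obtain s b where sb: "e0 = {s, b}" "s \<in> T" "lift \<chi> ` e0 = {s, lift \<chi> b}"
          "b \<notin> T \<Longrightarrow> \<chi> b \<in> cls b"
          using lift_edge[OF i(2,3,4)] by blast
        have "lift \<chi> b \<in> T" using sb(3) i(5) xv True by auto
        then have "b \<in> T" using sb(4) by (auto simp: lift_def cls_def split: if_splits)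
        then have "e0 = e" using sb(1,3) i(5) by (simp add: lift_def)
        then show "i \<in> Sigma {p \<in> PP. e \<in> path_edges p} lifts" using i by auto
      qed
      then have "(\<Sum>i | i \<in> I \<and> e \<in> path_edges (g i). a i) \<le> (\<Sum>i\<in>Sigma {p \<in> PP. e \<in> path_edges p} lifts. a i)"
        by (intro sum_mono2) (use fPP f_lifts a0 in \<open>auto simp: I_def\<close>)
      also have "\<dots> \<le> (\<Sum>p | p \<in> PP \<and> e \<in> path_edges p. h p)"
        unfolding sum_all using q1
        by (intro divide_left_mono[of 1 q, simplified] sum_nonneg) (auto simp: PP_def)
      also have "\<dots> \<le> cap G e"
      proof -
        have "\<phi> ` e = e" using xv True \<phi>_T by auto
        then have eH: "e \<in> edges H" using e by (metis contract_simps(2) imageI)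
        have "cap H e = cap G e" by (rule cap_H_terminal_edge(2)[OF eH]) (use xv True in auto)
        then show ?thesis using flow_le[OF eH] by linarith
      qed
      finally show ?thesis .
    next
      case False
      define m where "m = \<phi> v"
      define A where "A = {p \<in> PP. {x, m} \<in> path_edges p}"
      have mT: "m \<notin> T" unfolding m_def using False xv(3) \<phi>_in_T_iff by blast
      have vm: "v \<in> cls m" using False xv by (auto simp: cls_def m_def)
      have Am: "m \<in> set p - T" "x \<in> nbr p m" "p \<in> PP" if "p \<in> A" for p
        using that mT path_edges_subset[of "{x, m}" p] by (auto simp: A_def nbr_def)
      \<comment> \<open>To load \<open>e\<close>, the path must run through \<open>{x, m}\<close>
        and the lift must choose \<open>v\<close> at \<open>m\<close>.\<close>
      have sub: "{i \<in> I. e \<in> path_edges (g i)} \<subseteq> Sigma A (\<lambda>p. {\<chi> \<in> lifts p. \<chi> m = v})"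
      proof
        fix i assume "i \<in> {i \<in> I. e \<in> path_edges (g i)}"
        then obtain p \<chi> e0 where i: "i = (p, \<chi>)" "p \<in> PP" "\<chi> \<in> lifts p" "e0 \<in> path_edges p" "e = lift \<chi> ` e0"
          by (auto simp: I_def g_def path_edges_map)
        obtain s b where sb: "e0 = {s, b}" "s \<in> T" "lift \<chi> ` e0 = {s, lift \<chi> b}"
          "b \<notin> T \<Longrightarrow> \<chi> b \<in> cls b"
          using lift_edge[OF i(2,3,4)] by blast
        have sx: "s = x" "lift \<chi> b = v" using sb(2,3) i(5) xv False by (auto simp: doubleton_eq_iff)
        then have b: "b \<notin> T" "\<chi> b = v" using False by (auto simp: lift_def split: if_splits)
        then have "b = m" using sb(4) by (auto simp: cls_def m_def)
        then show "i \<in> Sigma A (\<lambda>p. {\<chi> \<in> lifts p. \<chi> m = v})" using i sb sx b by (auto simp: A_def)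
      qed
      have fA: "finite A" using fPP by (simp add: A_def)
      have "(\<Sum>i | i \<in> I \<and> e \<in> path_edges (g i). a i)
          \<le> (\<Sum>i\<in>Sigma A (\<lambda>p. {\<chi> \<in> lifts p. \<chi> m = v}). a i)"
        by (intro sum_mono2 sub) (use fA f_lifts a0 in \<open>auto simp: I_def A_def\<close>)
      also have "\<dots> = (\<Sum>p\<in>A. \<Sum>\<chi>\<in>{\<chi> \<in> lifts p. \<chi> m = v}. h p * W p \<chi> / q)"
        unfolding a_def by (rule sum.Sigma[symmetric]) (use fA f_lifts in auto)
      also have "\<dots> = (\<Sum>p\<in>A. h p * wt p m v) / q"
        unfolding sum_divide_distrib
        by (rule sum.cong) (auto simp: sum_divide_distrib[symmetric] sum_distrib_left[symmetric]
            sumW_at[OF Am(3,1) vm])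
      also have "\<dots> \<le> cap G e"
      proof (cases "A = {}")
        case True
        then show ?thesis using cap_nonneg[OF e] by simp
      next
        case A: False
        then have cx: "0 < ?c v x" and Cx: "0 < ?C m x"
          using nbr_c[OF Am(3,1,2) vm] nbr_C[OF Am(3,1,2)] by auto
        \<comment> \<open>The flow on \<open>{t, m}\<close> is at most the class capacity, so the
          share of \<open>v\<close> in it is at most the capacity of \<open>v\<close>. For class
          capacity 0 the quotient is 0 by convention.\<close>
        have flow: "?c v t / ?C m t * (\<Sum>p | p \<in> PP \<and> {t, m} \<in> path_edges p. h p) \<le> ?c v t" if "t \<in> T" for t
        proof (cases "?C m t = 0")
          case False
          then have "0 < ?C m t" using class_cap_nonneg[of m t] by linarith
          then have "?c v t / ?C m t * (\<Sum>p | p \<in> PP \<and> {t, m} \<in> path_edges p. h p) \<le> ?c v t / ?C m t * ?C m t"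
            by (intro mult_left_mono flow_le_C mT that divide_nonneg_nonneg star_cap_nonneg class_cap_nonneg)
          then show ?thesis using False by simp
        qed (simp add: star_cap_nonneg)
        let ?F = "\<lambda>p t. if far m x t \<and> {t, m} \<in> path_edges p then ?c v t / ?C m t else 0"
        have "(\<Sum>p\<in>A. h p * wt p m v) \<le> (\<Sum>p\<in>A. h p * (\<rho> * ?c v x / ?C m x + (\<Sum>t\<in>T. ?F p t)))"
          by (intro sum_mono mult_left_mono wt_le Am vm) (auto simp: A_def PP_def)
        also have "\<dots> = \<rho> * (?c v x / ?C m x * (\<Sum>p\<in>A. h p)) + (\<Sum>p\<in>A. \<Sum>t\<in>T. h p * ?F p t)"
          by (simp add: distrib_left sum.distrib sum_distrib_left sum_distrib_right mult_ac sum_divide_distrib)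
        also have "(\<Sum>p\<in>A. \<Sum>t\<in>T. h p * ?F p t) = (\<Sum>t\<in>T. \<Sum>p\<in>A. h p * ?F p t)"
          by (rule sum.swap)
        \<comment> \<open>Each far terminal \<open>t\<close> adds at most the whole capacity of
          \<open>v\<close> at \<open>t\<close>, which \<open>small\<close> bounds by a fraction
          \<open>\<delta>\<close> of the capacity at \<open>x\<close>.\<close>
        also have "\<dots> \<le> (\<Sum>t\<in>T. \<delta> * ?c v x)"
        proof (rule sum_mono)
          fix t assume t: "t \<in> T"
          show "(\<Sum>p\<in>A. h p * ?F p t) \<le> \<delta> * ?c v x"
          proof (cases "far m x t \<and> 0 < ?c v t")
            case True
            have "(\<Sum>p\<in>A. h p * ?F p t) \<le> (\<Sum>p\<in>PP. h p * ?F p t)"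
              by (rule sum_mono2) (use fPP in \<open>auto simp: A_def PP_def intro!: mult_nonneg_nonneg
                divide_nonneg_nonneg star_cap_nonneg class_cap_nonneg\<close>)
            also have "\<dots> = (\<Sum>p | p \<in> PP \<and> {t, m} \<in> path_edges p. h p * (?c v t / ?C m t))"
              by (rule sum.mono_neutral_cong_right) (use fPP True in auto)
            also have "\<dots> \<le> ?c v t" using flow[OF t] by (simp add: sum_distrib_left mult_ac)
            also have "\<dots> \<le> \<delta> * ?c v x" using small[OF vm xv(2) t cx] True by blast
            finally show ?thesis .
          next
            case False
            then have "?c v t = 0 \<or> \<not> far m x t" using star_cap_nonneg[of v t] by linarith
            then have "?F p t = 0" for p by auto
            then show ?thesis using \<delta> cx by simp
          qed
        qed
        also have "\<dots> = card T * \<delta> * ?c v x" by simp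
        also have "\<rho> * (?c v x / ?C m x * (\<Sum>p\<in>A. h p)) \<le> \<rho> * ?c v x"
          using flow[OF xv(2)] \<rho> by (intro mult_left_mono) (auto simp: A_def)
        finally have "(\<Sum>p\<in>A. h p * wt p m v) \<le> (\<rho> + card T * \<delta>) * ?c v x"
          by (simp add: distrib_right)
        also have "\<dots> \<le> q * ?c v x" using q cx by (intro mult_right_mono) auto
        finally have "(\<Sum>p\<in>A. h p * wt p m v) / q \<le> ?c v x" using q1 by (simp add: field_simps)
        also have "\<dots> = cap G e" using e xv by (simp add: star_cap_def insert_commute)
        finally show ?thesis .
      qed
      finally show ?thesis .
    qed
  qed
qed

end

section \<open>Types of stars\<close>

text \<open>Compressing the gaps longer than \<open>L\<close> between the levels \<open>l s\<close>, \<open>s \<in> S\<close>, bounds the number of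
  possible level profiles, while differences smaller than \<open>L\<close> are kept exactly.\<close>

definition squash :: "nat \<Rightarrow> 'b set \<Rightarrow> ('b \<Rightarrow> int) \<Rightarrow> 'b \<Rightarrow> nat" where
  "squash L S l t = card ((\<Union>r\<in>S. {l r<..l r + int L}) \<inter> {l t<..})"

lemma squash_le:
  assumes "finite S"
  shows "squash L S l t \<le> card S * L"
proof -
  have "squash L S l t \<le> card (\<Union>r\<in>S. {l r<..l r + int L})"
    unfolding squash_def by (rule card_mono) (use assms in auto)
  also have "\<dots> \<le> (\<Sum>r\<in>S. card {l r<..l r + int L})"
    by (rule card_UN_le[OF assms])
  finally show ?thesis by simp
qed

text \<open>\<open>D\<close> counts the points of \<open>{l t<..l s}\<close> covered by the windows
  of length \<open>L\<close>. If the interval is no longer than \<open>L\<close>, the window at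
  \<open>t\<close> alone covers it; otherwise this window already contributes \<open>L\<close>
  points.\<close>

lemma squash_diff:
  assumes S: "finite S" "s \<in> S" "t \<in> S" and le: "l t \<le> l s"
  shows "\<exists>D. squash L S l t = squash L S l s + D \<and> int D \<le> l s - l t
    \<and> (D < L \<longrightarrow> int D = l s - l t)"
proof -
  define U where "U = (\<Union>r\<in>S. {l r<..l r + int L})"
  define D where "D = card (U \<inter> {l t<..l s})"
  have fU: "finite U" using S by (simp add: U_def)
  have "U \<inter> {l t<..} = (U \<inter> {l s<..}) \<union> (U \<inter> {l t<..l s})" using le by auto
  then have "squash L S l t = squash L S l s + D"
    unfolding squash_def U_def[symmetric] D_def using fU by (simp add: card_Un_disjoint Int_ac disjoint_iff)
  moreover have "D \<le> card {l t<..l s}" unfolding D_def by (rule card_mono) auto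
  then have "int D \<le> l s - l t" using le by simp
  moreover have "int D = l s - l t" if "D < L"
  proof (cases "l s - l t \<le> int L")
    case True
    then have "U \<inter> {l t<..l s} = {l t<..l s}" using S(3) by (fastforce simp: U_def)
    then show ?thesis using le by (simp add: D_def)
  next
    case False
    have "card {l t<..l t + int L} \<le> D"
      unfolding D_def by (rule card_mono) (use fU False S(3) in \<open>auto simp: U_def\<close>)
    then show ?thesis using that by simp
  qed
  ultimately show ?thesis by blast
qed

text \<open>Compression never enlarges a gap. The opposite order is excluded because
  \<open>squash\<close> never grows with the level and \<open>L\<close> is positive.\<close>

lemma squash_far:
  assumes S: "finite S" "s \<in> S" "t \<in> S"
    and "0 < L" "squash L S l s + L \<le> squash L S l t"
  shows "l t + int L \<le> l s"
proof (cases "l t \<le> l s")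
  case True
  from squash_diff[of S s t l L, OF S True] show ?thesis using assms(5) by auto
next
  case False
  then have "l s \<le> l t" by simp
  from squash_diff[of S t s l L, OF S(1,3,2) this] show ?thesis using assms(4,5) by auto
qed

text \<open>A compressed gap below \<open>L\<close> has not been shortened, so the compressed values
  determine the signed difference of the levels.\<close>

lemma squash_near:
  assumes S: "finite S" "s \<in> S" "t \<in> S"
    and "\<not> squash L S l s + L \<le> squash L S l t" "\<not> squash L S l t + L \<le> squash L S l s"
  shows "l s - l t = int (squash L S l t) - int (squash L S l s)"
proof (cases "l t \<le> l s")
  case True
  from squash_diff[of S s t l L, OF S True] show ?thesis using assms(4) by auto
next
  case False
  then have "l s \<le> l t" by simp
  from squash_diff[of S t s l L, OF S(1,3,2) this] show ?thesis using assms(5) by auto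
qed

lemma powr_floor_log:
  fixes b x :: real
  assumes "1 < b" "0 < x"
  shows "b powr \<lfloor>log b x\<rfloor> \<le> x" "x < b powr (\<lfloor>log b x\<rfloor> + 1)"
proof -
  show "b powr \<lfloor>log b x\<rfloor> \<le> x"
    using assms by (simp add: powr_le_iff)
  show "x < b powr (\<lfloor>log b x\<rfloor> + 1)"
    using assms by (simp add: less_powr_iff)
qed

section \<open>Star types and the capacity ratios they control\<close>

definition levels :: "'a network \<Rightarrow> real \<Rightarrow> 'a \<Rightarrow> 'a \<Rightarrow> int" where
  "levels G b v t = \<lfloor>log b (star_cap G v t)\<rfloor>"

text \<open>The value \<open>card T * L + 1\<close> exceeds all values of \<open>squash\<close> and
  so marks the terminals outside the support. Restriction to \<open>T\<close> places the types in a
  finite function space.\<close>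

definition star_type :: "'a network \<Rightarrow> 'a set \<Rightarrow> real \<Rightarrow> nat \<Rightarrow> 'a \<Rightarrow> 'a \<Rightarrow> nat" where
  "star_type G T b L v = (\<lambda>t\<in>T. if 0 < star_cap G v t
     then squash L {s \<in> T. 0 < star_cap G v s} (levels G b v) t else card T * L + 1)"

lemma star_type_pos:
  assumes "t \<in> T" "0 < star_cap G v t"
  shows "star_type G T b L v t = squash L {s \<in> T. 0 < star_cap G v s} (levels G b v) t"
  using assms by (simp add: star_type_def)

lemma star_type_le:
  assumes "finite T"
  shows "squash L {s \<in> T. R s} l t \<le> card T * L"
proof -
  have "squash L {s \<in> T. R s} l t \<le> card {s \<in> T. R s} * L"
    by (rule squash_le) (use assms in simp)
  also have "\<dots> \<le> card T * L" by (intro mult_right_mono card_mono) (use assms in auto)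
  finally show ?thesis .
qed

lemma star_type_pos_iff:
  assumes "finite T" "t \<in> T"
  shows "0 < star_cap G v t \<longleftrightarrow> star_type G T b L v t \<le> card T * L"
  using star_type_le[OF assms(1)] assms(2) by (simp add: star_type_def)

lemma star_type_PiE:
  assumes "finite T"
  shows "star_type G T b L v \<in> T \<rightarrow>\<^sub>E {..card T * L + 1}"
  using star_type_le[OF assms] by (auto simp: star_type_def le_SucI)

text \<open>A gap of \<open>Suc n\<close> levels yields only the factor \<open>b ^ n\<close>: one
  level is lost by rounding down the logarithm of the capacity at \<open>t\<close>.\<close>

lemma star_type_far:
  assumes T: "finite T" "s \<in> T" "t \<in> T" and pos: "0 < star_cap G v s" "0 < star_cap G v t"
    and b: "1 < b" and far: "star_type G T b (Suc n) v s + Suc n \<le> star_type G T b (Suc n) v t"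
  shows "star_cap G v t * b ^ n \<le> star_cap G v s"
proof -
  have "levels G b v t + int (Suc n) \<le> levels G b v s"
    using far T pos unfolding star_type_pos[OF T(2) pos(1)] star_type_pos[OF T(3) pos(2)]
    by (intro squash_far[where S = "{s \<in> T. 0 < star_cap G v s}"]) auto
  then have le: "real_of_int (levels G b v t) + 1 + n \<le> levels G b v s" by linarith
  have "star_cap G v t * b ^ n \<le> b powr (levels G b v t + 1) * b ^ n"
    using powr_floor_log(2)[OF b pos(2)] b by (intro mult_right_mono) (auto simp: levels_def)
  also have "\<dots> = b powr (real_of_int (levels G b v t) + 1 + n)"
    using b by (simp add: powr_add powr_realpow)
  also have "\<dots> \<le> b powr levels G b v s" using le b by (intro powr_mono) auto
  also have "\<dots> \<le> star_cap G v s" unfolding levels_def by (rule powr_floor_log(1)[OF b pos(1)])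
  finally show ?thesis .
qed

text \<open>Equal types give \<open>u\<close> and \<open>v\<close> the same level difference between
  \<open>s\<close> and \<open>t\<close>. Rounding costs at most a factor \<open>b\<close> for each
  of the two capacities on the left.\<close>

lemma star_type_near:
  assumes T: "finite T" "s \<in> T" "t \<in> T"
    and pos: "0 < star_cap G v s" "0 < star_cap G v t"
    and eq: "star_type G T b L u = star_type G T b L v" and b: "1 < b"
    and near: "\<not> star_type G T b L v s + L \<le> star_type G T b L v t"
      "\<not> star_type G T b L v t + L \<le> star_type G T b L v s"
  shows "star_cap G v t * star_cap G u s \<le> b\<^sup>2 * star_cap G u t * star_cap G v s"
proof -
  let ?l = "levels G b"
  have diff: "?l w s - ?l w t = int (star_type G T b L v t) - int (star_type G T b L v s)"
    if w: "star_type G T b L w = star_type G T b L v" "0 < star_cap G w s" "0 < star_cap G w t" for w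
    using near T w(2,3) unfolding w(1)[symmetric] star_type_pos[OF T(2) w(2)] star_type_pos[OF T(3) w(3)]
    by (intro squash_near[where S = "{s \<in> T. 0 < star_cap G w s}"]) auto
  have posu: "0 < star_cap G u s" "0 < star_cap G u t"
    using pos eq star_type_pos_iff[OF T(1)] T(2,3) by metis+
  have "?l v s - ?l v t = ?l u s - ?l u t" using diff[OF eq posu] diff[OF refl pos] by simp
  then have sum: "real_of_int (?l v t + 1) + real_of_int (?l u s + 1) = real_of_int (2 + ?l u t + ?l v s)"
    by linarith
  have "star_cap G v t * star_cap G u s \<le> b powr (?l v t + 1) * b powr (?l u s + 1)"
    using powr_floor_log(2)[OF b pos(2)] powr_floor_log(2)[OF b posu(1)] pos posu
    by (intro mult_mono) (auto simp: levels_def)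
  also have "\<dots> = b powr (2 + ?l u t + ?l v s)"
    unfolding powr_add[symmetric] sum ..
  also have "\<dots> = b\<^sup>2 * b powr (?l u t) * b powr (?l v s)"
    using b by (simp add: powr_add)
  also have "\<dots> \<le> b\<^sup>2 * star_cap G u t * star_cap G v s"
    using powr_floor_log(1)[OF b pos(1)] powr_floor_log(1)[OF b posu(2)] b posu
    by (intro mult_mono) (auto simp: levels_def)
  finally show ?thesis .
qed

section \<open>Merging nonterminals of equal type\<close>

text \<open>What remains are the terminals and one nonterminal per occurring type. With rounding
  base \<open>1 + \<eta>\<close>, near hops cost the factor \<open>(1 + \<eta>)\<^sup>2\<close>, and
  all far hops together add at most \<open>\<eta>\<close>.\<close>

lemma exists_contraction:
  fixes G :: "'a network" and \<eta> :: real
  assumes G: "terminal_network G T" and qb: "quasi_bipartite G T" and \<eta>: "0 < \<eta>" "\<eta> \<le> 1"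
  defines "k \<equiv> card T"
  defines "L \<equiv> Suc (nat \<lceil>k / \<eta>\<^sup>2\<rceil>)"
  shows "\<exists>H. terminal_network H T \<and> (\<forall>d. routable G T d \<longrightarrow> routable H T d)
    \<and> (\<forall>d. routable H T d \<longrightarrow> routable G T (\<lambda>P. d P / (1 + 4 * \<eta>)))
    \<and> card (verts H) \<le> k + (k * L + 2) ^ k"
proof -
  define n where "n = nat \<lceil>k / \<eta>\<^sup>2\<rceil>"
  define b where "b = 1 + \<eta>"
  have L: "L = Suc n" by (simp add: L_def n_def)
  have b: "1 < b" using \<eta> by (simp add: b_def)
  have fV: "finite (verts G)" and TV: "T \<subseteq> verts G" using G by (auto simp: terminal_network_def)
  have fT: "finite T" using fV TV finite_subset by blast
  let ?N = "verts G - T"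
  define \<tau> where "\<tau> = star_type G T b L"
  \<comment> \<open>Taking the merged vertex from its own class keeps the vertex type and gives
    \<open>m\<close> the star type of its class, so \<open>far\<close> can be read off from
    \<open>\<tau> m\<close>.\<close>
  define rep where "rep x = (SOME u. u \<in> ?N \<and> \<tau> u = x)" for x
  define \<phi> where "\<phi> v = (if v \<in> ?N then rep (\<tau> v) else v)" for v
  have \<phi>: "\<phi> v \<in> ?N \<and> \<tau> (\<phi> v) = \<tau> v" if "v \<in> ?N" for v
  proof -
    have "\<exists>u. u \<in> ?N \<and> \<tau> u = \<tau> v" using that by blast
    from someI_ex[OF this] show ?thesis using that by (simp add: \<phi>_def rep_def)
  qed
  interpret star_contraction G T \<phi>
    by unfold_locales (use G qb \<phi> in \<open>auto simp: \<phi>_def\<close>)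
  have cls_\<tau>: "\<tau> v = \<tau> m" if "v \<in> cls m" for v m
    using that \<phi> by (auto simp: cls_def)
  \<comment> \<open>A far terminal must be weaker by the factor \<open>k / \<eta>\<close>, so that
    \<open>k\<close> of them cost only \<open>\<eta>\<close>. By Bernoulli's inequality
    \<open>n \<ge> k / \<eta>\<^sup>2\<close> suffices.\<close>
  have pow: "k / \<eta> \<le> b ^ n"
  proof -
    have "k / \<eta>\<^sup>2 \<le> n" unfolding n_def by (rule real_nat_ceiling_ge)
    then have "k / \<eta>\<^sup>2 * \<eta> \<le> n * \<eta>" using \<eta> by (intro mult_right_mono) auto
    then have "k / \<eta> \<le> n * \<eta>" using \<eta> by (simp add: power2_eq_square)
    also have "\<dots> \<le> b ^ n" using Bernoulli_inequality[of \<eta> n] \<eta> by (simp add: b_def)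
    finally show ?thesis .
  qed
  have "routable G T (\<lambda>P. d P / (1 + 4 * \<eta>))" if "routable H T d" for d
  proof (rule routable_G[where far = "\<lambda>m s t. \<tau> m s + L \<le> \<tau> m t" and \<delta> = "\<eta> / real k" and \<rho> = "b\<^sup>2"])
    show "\<not> \<tau> m t + L \<le> \<tau> m s" if "\<tau> m s + L \<le> \<tau> m t" for m s t using that L by simp
    show "0 < star_cap G v s" if "u \<in> cls m" "v \<in> cls m" "s \<in> T" "0 < star_cap G u s" for m u v s
      using that cls_\<tau> star_type_pos_iff[OF fT that(3)] unfolding \<tau>_def by metis
    show "star_cap G v t \<le> \<eta> / k * star_cap G v s"
      if "v \<in> cls m" "s \<in> T" "t \<in> T" "0 < star_cap G v s" "0 < star_cap G v t" "\<tau> m s + L \<le> \<tau> m t"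
      for m v s t
    proof -
      have k: "0 < k" using that(2) fT by (auto simp: k_def card_gt_0_iff)
      have "star_cap G v t * (k / \<eta>) \<le> star_cap G v t * b ^ n"
        using pow that(5) by (intro mult_left_mono) auto
      also have "\<dots> \<le> star_cap G v s"
        using that(6) cls_\<tau>[OF that(1)]
        by (intro star_type_far[OF fT that(2-5) b]) (auto simp: \<tau>_def L)
      finally show ?thesis using k \<eta> by (simp add: field_simps)
    qed
    show "star_cap G v t * star_cap G u s \<le> b\<^sup>2 * star_cap G u t * star_cap G v s"
      if "u \<in> cls m" "v \<in> cls m" "s \<in> T" "t \<in> T" "0 < star_cap G v s" "0 < star_cap G v t"
        "\<not> \<tau> m s + L \<le> \<tau> m t" "\<not> \<tau> m t + L \<le> \<tau> m s" for m u v s t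
      using that(7,8) cls_\<tau>[OF that(1)] cls_\<tau>[OF that(2)]
      by (intro star_type_near[OF fT that(3-6) _ b, where L = L]) (auto simp: \<tau>_def)
    show "1 \<le> b\<^sup>2" using b by simp
    show "0 \<le> \<eta> / k" using \<eta> by simp
    have "card T * (\<eta> / k) \<le> \<eta>" using \<eta> by (simp add: k_def)
    \<comment> \<open>In \<open>1 + 2 * \<eta> + \<eta>\<^sup>2\<close> the square is at most
      \<open>\<eta>\<close> because \<open>\<eta> \<le> 1\<close>.\<close>
    moreover have "b\<^sup>2 \<le> 1 + 3 * \<eta>"
      using mult_left_mono[OF \<eta>(2), of \<eta>] \<eta>(1) by (simp add: b_def power2_eq_square algebra_simps)
    ultimately show "b\<^sup>2 + card T * (\<eta> / k) \<le> 1 + 4 * \<eta>" by linarith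
  qed (rule that)
  moreover have "card (verts H) \<le> k + (k * L + 2) ^ k"
  proof -
    have "\<phi> ` T = T" "\<phi> ` ?N = rep ` \<tau> ` ?N" by (auto simp: \<phi>_def image_iff)
    moreover have "verts H = \<phi> ` T \<union> \<phi> ` ?N" using TV by auto
    ultimately have "card (verts H) \<le> card T + card (rep ` \<tau> ` ?N)" by (metis card_Un_le)
    also have "card (rep ` \<tau> ` ?N) \<le> card (\<tau> ` ?N)" by (rule card_image_le) (use fV in auto)
    also have "\<dots> \<le> card (T \<rightarrow>\<^sub>E {..k * L + 1})"
    proof (rule card_mono)
      show "finite (T \<rightarrow>\<^sub>E {..k * L + 1})" using fT by (simp add: finite_PiE)
      show "\<tau> ` ?N \<subseteq> T \<rightarrow>\<^sub>E {..k * L + 1}"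
        unfolding \<tau>_def k_def using star_type_PiE[OF fT] by blast
    qed
    also have "\<dots> = (k * L + 2) ^ k" using fT by (simp add: card_PiE k_def)
    finally show ?thesis by (simp add: k_def)
  qed
  ultimately show ?thesis using terminal_network_H routable_H by blast
qed

section \<open>Quality and size of the sparsifier\<close>

text \<open>Applied to the multiples of \<open>d\<close>, the assumptions say that factors feasible
  in \<open>G\<close> are feasible in \<open>H\<close>, and factors feasible in \<open>H\<close>
  become feasible in \<open>G\<close> after division by \<open>q\<close>. Both sets are nonempty and
  bounded, so this passes to suprema.\<close>

lemma flow_sparsifier_if_routable:
  assumes G: "terminal_network G T" and H: "terminal_network H T" and q: "1 \<le> q"
    and GH: "\<And>d. routable G T d \<Longrightarrow> routable H T d"
    and HG: "\<And>d. routable H T d \<Longrightarrow> routable G T (\<lambda>P. d P / q)"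
  shows "flow_sparsifier G T q H"
  unfolding flow_sparsifier_def
proof (intro conjI allI impI)
  fix d assume d: "nonzero_demand T d"
  let ?S = "\<lambda>G. {l. 0 \<le> l \<and> routable G T (\<lambda>P. l * d P)}"
  show "concurrent_flow G T d \<le> concurrent_flow H T d"
    unfolding concurrent_flow_def
  proof (rule cSup_subset_mono)
    show "?S G \<noteq> {}" using routable_zero[OF G] by blast
    show "bdd_above (?S H)" by (rule bdd_above_concurrent_flow[OF H d])
  qed (use GH in auto)
  show "concurrent_flow H T d \<le> q * concurrent_flow G T d"
    unfolding concurrent_flow_def[of H]
  proof (rule cSup_least)
    show "?S H \<noteq> {}" using routable_zero[OF H] by blast
    fix l assume l: "l \<in> ?S H"
    then have "l / q \<in> ?S G" using HG[of "\<lambda>P. l * d P"] q by simp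
    then have "l / q \<le> concurrent_flow G T d"
      unfolding concurrent_flow_def by (rule cSup_upper[OF _ bdd_above_concurrent_flow[OF G d]])
    then show "l \<le> q * concurrent_flow G T d" using q by (simp add: field_simps)
  qed
qed (use q H in auto)

text \<open>All constants and the powers of \<open>k\<close> are absorbed into powers of
  \<open>1 / \<epsilon>\<close>, which exceeds 8. The last \<open>+ 1\<close> in the exponent pays
  for the factor 2 that arises from adding \<open>k\<close>.\<close>

lemma number_of_types_le:
  fixes \<epsilon> :: real and k :: nat
  assumes \<epsilon>: "0 < \<epsilon>" "\<epsilon> < 1 / 8"
  shows "real (k + (k * Suc (nat \<lceil>k / (\<epsilon> / 4)\<^sup>2\<rceil>) + 2) ^ k) \<le> (1 / \<epsilon>) powr (k * (2 * ln k + 5) + 1)"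
proof -
  define E where "E = 1 / \<epsilon>"
  have E: "8 < E" using \<epsilon> by (simp add: E_def field_simps)
  show ?thesis
  proof (cases "k = 0")
    case True
    then show ?thesis using \<epsilon> by (simp add: field_simps)
  next
    case False
    then have k: "1 \<le> real k" by simp
    have "real k \<le> 2 powr real k"
      using of_nat_less_two_power[of k] by (simp add: powr_realpow)
    also have "\<dots> \<le> E powr k" using E by (intro powr_mono2) auto
    also have "\<dots> \<le> E powr (k * (2 * ln k + 5))" using E k by (intro powr_mono) auto
    finally have 1: "real k \<le> E powr (k * (2 * ln k + 5))" .
    \<comment> \<open>Since \<open>ln E \<ge> 1\<close>, the identity
      \<open>k\<^sup>2 = exp (2 * ln k)\<close> bounds a power of \<open>k\<close> by a power of
      \<open>E\<close>; the logarithmic factor of the final exponent comes from here.\<close>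
    have k2: "(real k)\<^sup>2 \<le> E powr (2 * ln k)"
    proof -
      have "1 \<le> ln E" using E exp_le by (simp add: ln_ge_iff)
      then have "2 * ln k * 1 \<le> 2 * ln k * ln E" using k by (intro mult_left_mono) auto
      then have "exp (2 * ln k) \<le> E powr (2 * ln k)" using E by (simp add: powr_def)
      moreover have "exp (2 * ln k) = (real k)\<^sup>2"
        using k by (simp add: exp_double)
      ultimately show ?thesis by simp
    qed
    define N where "N = nat \<lceil>k / (\<epsilon> / 4)\<^sup>2\<rceil>"
    have "0 \<le> k / (\<epsilon> / 4)\<^sup>2" by simp
    then have "real N \<le> k / (\<epsilon> / 4)\<^sup>2 + 1" unfolding N_def by linarith
    then have "real N + 1 \<le> 16 * k * E\<^sup>2 + 2" by (simp add: E_def power_divide mult.commute)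
    then have "real k * (real N + 1) \<le> k * (16 * k * E\<^sup>2 + 2)" by (rule mult_left_mono) simp
    moreover have "real (k * Suc N + 2) = real k * (real N + 1) + 2" by (simp add: algebra_simps)
    ultimately have "real (k * Suc N + 2) \<le> k * (16 * k * E\<^sup>2 + 2) + 2" by linarith
    also have "\<dots> \<le> 20 * (real k)\<^sup>2 * E\<^sup>2"
    proof -
      have kk: "1 \<le> (real k)\<^sup>2" "real k \<le> (real k)\<^sup>2"
        using k mult_mono[OF k k] mult_left_mono[OF k, of "real k"]
        by (simp_all add: power2_eq_square)
      have "1 \<le> E\<^sup>2" using E by simp
      then have "(real k)\<^sup>2 * 1 \<le> (real k)\<^sup>2 * E\<^sup>2" by (intro mult_left_mono) auto
      then show ?thesis using kk by (simp add: algebra_simps power2_eq_square)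
    qed
    also have "\<dots> \<le> E ^ 3 * E powr (2 * ln k) * E\<^sup>2"
    proof (intro mult_right_mono mult_mono k2)
      have "(8::real) ^ 3 \<le> E ^ 3" using E by (intro power_mono) auto
      then show "20 \<le> E ^ 3" by simp
    qed (use E in auto)
    also have "\<dots> = E powr (2 * ln k + 5)"
    proof -
      have "E ^ 3 = E powr 3" "E\<^sup>2 = E powr 2" using E by (simp_all add: powr_numeral)
      then show ?thesis by (simp add: powr_add[symmetric] add.commute)
    qed
    finally have "real (k * Suc N + 2) ^ k \<le> (E powr (2 * ln k + 5)) ^ k"
      by (intro power_mono) auto
    also have "\<dots> = E powr (k * (2 * ln k + 5))" using E by (simp add: powr_powr powr_realpow[symmetric] mult.commute)
    finally have "real (k + (k * Suc N + 2) ^ k) \<le> 2 * E powr (k * (2 * ln k + 5))"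
      using 1 by simp
    also have "\<dots> \<le> E * E powr (k * (2 * ln k + 5))" using E by (intro mult_right_mono) auto
    also have "\<dots> = E powr (k * (2 * ln k + 5) + 1)" using E by (simp add: powr_add)
    finally show ?thesis by (simp add: E_def N_def)
  qed
qed

theorem theorem5p3:
  shows "\<exists>f \<in> soft_bigo (\<lambda>k. real k).
    \<forall>(G :: 'a network) (T :: 'a set) (k :: nat) (\<epsilon> :: real).
      terminal_network G T \<and> card T = k \<and> quasi_bipartite G T \<and> 0 < \<epsilon> \<and> \<epsilon> < 1 / 8 \<longrightarrow>
      (\<exists>H. flow_sparsifier G T (1 + \<epsilon>) H \<and> real (card (verts H)) \<le> (1 / \<epsilon>) powr f k)"
proof (intro bexI allI impI)
  let ?f = "\<lambda>k::nat. real k * (2 * ln (real k) + 5) + 1"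
  have "?f \<in> O(\<lambda>k. real k * ln (real k) ^ 1)"
  proof (rule landau_o.bigI[of 8])
    show "\<forall>\<^sub>F k in sequentially. norm (?f k) \<le> 8 * norm (real k * ln (real k) ^ 1)"
    proof (rule eventually_sequentiallyI[of 3])
      fix k :: nat assume k: "3 \<le> k"
      have "exp 1 \<le> real k" using exp_le k by linarith
      then have ln: "1 \<le> ln (real k)" using k by (simp add: ln_ge_iff)
      then have "real k \<le> real k * ln (real k)" using k by simp
      moreover have "?f k = 2 * (real k * ln (real k)) + 5 * real k + 1" by (simp add: algebra_simps)
      ultimately have "?f k \<le> 8 * (real k * ln (real k))" using k by linarith
      then show "norm (?f k) \<le> 8 * norm (real k * ln (real k) ^ 1)"
        using ln by simp
    qed
  qed simp
  then show "?f \<in> soft_bigo (\<lambda>k. real k)" unfolding soft_bigo_def by blast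
  fix G :: "'a network" and T k \<epsilon>
  assume "terminal_network G T \<and> card T = k \<and> quasi_bipartite G T \<and> 0 < \<epsilon> \<and> \<epsilon> < (1 / 8 :: real)"
  then have G: "terminal_network G T" "quasi_bipartite G T" and k: "card T = k"
    and \<epsilon>: "0 < \<epsilon>" "\<epsilon> < 1 / 8" by auto
  have "0 < \<epsilon> / 4" "\<epsilon> / 4 \<le> 1" using \<epsilon> by auto
  from exists_contraction[OF G this] obtain H where H: "terminal_network H T"
    "\<And>d. routable G T d \<Longrightarrow> routable H T d"
    "\<And>d. routable H T d \<Longrightarrow> routable G T (\<lambda>P. d P / (1 + \<epsilon>))"
    and card: "card (verts H) \<le> k + (k * Suc (nat \<lceil>k / (\<epsilon> / 4)\<^sup>2\<rceil>) + 2) ^ k"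
    using k by auto
  have "flow_sparsifier G T (1 + \<epsilon>) H"
    by (rule flow_sparsifier_if_routable) (use G H \<epsilon> in auto)
  moreover have "real (card (verts H)) \<le> (1 / \<epsilon>) powr ?f k"
    using number_of_types_le[OF \<epsilon>, of k] card by linarith
  ultimately show "\<exists>H. flow_sparsifier G T (1 + \<epsilon>) H \<and> real (card (verts H)) \<le> (1 / \<epsilon>) powr ?f k"
    by blast
qed

end
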